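(* Let $0<q<1$, let $\alpha>0$ be real, let $0<a<x<1$, and let $b,c,d$ be parameters (complex numbers). If $\max\{|a|,|b|,|c|,|d|\}<1$, then $$ \int_0^\pi\frac{h(\cos2\theta;1)}{h(\cos\theta;a,b,c,d)}\sum_{k=0}^{\infty}\frac{x^{\alpha+k}(a/x;q)_{\alpha+k}}{a^{k}(q;q)_{\alpha+k}}\;{}_4\phi_3\left[\begin{matrix}q^{-k},\,abcd,\,ae^{i\theta},\,ae^{-i\theta}\\ ab,\,ac,\,ad\end{matrix};q,q\right]d\theta =\frac{2\pi\,(abcd;q)_\infty}{(q,ab,ac,ad,bc,bd,cd;q)_\infty}\cdot\frac{x^{\alpha}(a/x;q)_\alpha}{(q;q)_\alpha}. $$
   Context: Notation ($0<q<1$). $(c;q)_0=1$, $(c;q)_n=\prod_{k=0}^{n-1}(1-cq^k)$, $(c;q)_\infty=\prod_{k=0}^{\infty}(1-cq^k)$; for real $\nu$, $(c;q)_\nu=(c;q)_\infty/(cq^{\nu};q)_\infty$ (the standard extension). For $n$ a nonnegative integer or $\infty$, $(c_1,\dots,c_m;q)_n=(c_1;q)_n\cdots(c_m;q)_n$. Basic hypergeometric series: $${}_r\phi_s\left[\begin{matrix}a_1,\dots,a_r\\ b_1,\dots,b_s\end{matrix};q,w\right]=\sum_{n=0}^\infty\frac{(a_1,\dots,a_r;q)_n}{(q,b_1,\dots,b_s;q)_n}\left[(-1)^nq^{n(n-1)/2}\right]^{1+s-r}w^n ;$$ in particular, with $q^{-k}$ as an upper parameter ($k$ a nonnegative integer)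 the series terminates at $n=k$. $h(\cos\theta;a)=(ae^{i\theta},ae^{-i\theta};q)_\infty$ and $h(\cos\theta;a_1,\dots,a_m)=h(\cos\theta;a_1)\cdots h(\cos\theta;a_m)$; thus $h(\cos2\theta;1)=(e^{2i\theta},e^{-2i\theta};q)_\infty$. *)

theory Defs
  imports "HOL-Analysis.Analysis"
begin

definition qpoch :: "complex \<Rightarrow> real \<Rightarrow> nat \<Rightarrow> complex" where
  "qpoch c q n = (\<Prod>k<n. 1 - c * of_real q ^ k)"

definition qpoch_inf :: "complex \<Rightarrow> real \<Rightarrow> complex" where
  "qpoch_inf c q = (\<Prod>k. 1 - c * of_real q ^ k)"

(* (c;q)_\<nu> for real \<nu>; agrees with qpoch at \<nu> = n provided (c q^n;q)_\<infinity> is nonzero. *)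
definition qpoch_real :: "complex \<Rightarrow> real \<Rightarrow> real \<Rightarrow> complex" where
  "qpoch_real c q \<nu> = qpoch_inf c q / qpoch_inf (c * of_real (q powr \<nu>)) q"

definition qpochs :: "complex list \<Rightarrow> real \<Rightarrow> nat \<Rightarrow> complex" where
  "qpochs cs q n = (\<Prod>c\<leftarrow>cs. qpoch c q n)"

definition qpochs_inf :: "complex list \<Rightarrow> real \<Rightarrow> complex" where
  "qpochs_inf cs q = (\<Prod>c\<leftarrow>cs. qpoch_inf c q)"

(* r and s are the lengths of the two parameter lists; the exponent 1 + s - r is an
   integer and may be negative, hence powi. *)
definition basic_hyp :: "complex list \<Rightarrow> complex list \<Rightarrow> real \<Rightarrow> complex \<Rightarrow> complex" where
  "basic_hyp as bs q w =
     (\<Sum>n. qpochs as q n / qpochs (of_real q # bs) q n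
        * ((-1) ^ n * of_real q ^ (n * (n - 1) div 2)) powi (1 + int (length bs) - int (length as))
        * w ^ n)"

(* h(cos \<theta>; a_1, ..., a_m), taking the angle \<theta> itself rather than cos \<theta> as argument;
   so h(cos 2\<theta>; 1) is askey_h q (2 * \<theta>) [1]. *)
definition askey_h :: "real \<Rightarrow> real \<Rightarrow> complex list \<Rightarrow> complex" where
  "askey_h q \<theta> as = (\<Prod>a\<leftarrow>as. qpochs_inf [a * exp (\<i> * of_real \<theta>), a * exp (- \<i> * of_real \<theta>)] q)"

end

(* The 4-phi-3 is a q-binomial transform: (q^-k; q)_n / (q; q)_n are the coefficients of the
   polynomial prod_{1 <= j <= k} (1 - z / q^j) in z. Under the Askey-Wilson weight each of its
   terms (abcd, a e^it, a e^-it; q)_n / (ab, ac, ad; q)_n has the same integral as 1, because the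
   factor (a e^it, a e^-it; q)_n just turns a into a q^n. Evaluating the polynomial at z = q
   therefore kills the integral of every term of the outer sum except k = 0.

   To interchange sum and integral, write the n-th term as f(q^n) with f holomorphic on
   |w| < 1/a. The q-binomial transform annihilates the Taylor coefficients of f below order k, so
   Cauchy's estimate bounds the 4-phi-3 by C r^k for any r > a, while the coefficients in front
   of it grow only like (x/a)^k.

   The Askey-Wilson integral follows from its first moment, which a contour shift from |z| = 1 to
   |z| = 1/q provides. This gives a recurrence a -> a q, hence by iteration and continuity the
   reduction of all four parameters to 0. The remaining constant is read off at the parameters
   (q, -q, sqrt q, - sqrt q), where the weight is 2 - 2 cos 2t. *)
theory Submission
  imports Defs "HOL-Complex_Analysis.Complex_Analysis"
begin

section \<open>Infinite q-shifted factorials and the q-binomial transform\<close>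

lemma qpoch_0 [simp]: "qpoch c q 0 = 1"
  by (simp add: qpoch_def)

lemma qpoch_Suc: "qpoch c q (Suc n) = qpoch c q n * (1 - c * of_real q ^ n)"
  by (simp add: qpoch_def)

lemma qpoch_Suc_shift: "qpoch c q (Suc n) = (1 - c) * qpoch (c * of_real q) q n"
  unfolding qpoch_def by (subst prod.lessThan_Suc_shift) (simp add: mult_ac)

lemma qpoch_inf_0 [simp]: "qpoch_inf 0 q = 1"
  by (simp add: qpoch_inf_def)

context
  fixes q :: real
  assumes q: "0 < q" "q < 1"
begin

text \<open>On a disc of radius \<open>R\<close> the n-th factor differs from 1 by at most
  \<open>R * q ^ n\<close>. Uniformity in \<open>c\<close> is what makes the infinite product
  holomorphic.\<close>

lemma uniformly_convergent_qpoch: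
  "uniformly_convergent_on (cball 0 R) (\<lambda>n c. qpoch c q n)"
proof -
  have "uniformly_convergent_on (cball 0 R) (\<lambda>N x. \<Sum>n<N. norm (1 - x * complex_of_real q ^ n - 1))"
  proof (rule Weierstrass_m_test')
    show "norm (norm (1 - x * complex_of_real q ^ n - 1)) \<le> R * q ^ n" if "x \<in> cball 0 R" for n x
      using that q by (auto simp: norm_mult norm_power intro!: mult_right_mono)
    show "summable (\<lambda>n. R * q ^ n)"
      using q by (intro summable_mult summable_geometric) auto
  qed
  then have "uniformly_convergent_on (cball 0 R) (\<lambda>N x. \<Prod>n<N. 1 - x * complex_of_real q ^ n)"
    by (intro uniformly_convergent_on_prod') (auto intro!: continuous_intros)
  then show ?thesis by (simp add: qpoch_def)
qed

lemma convergent_prod_qpoch: "convergent_prod (\<lambda>k. 1 - c * complex_of_real q ^ k)"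
proof (rule abs_convergent_prod_imp_convergent_prod, rule summable_imp_abs_convergent_prod)
  have "summable (\<lambda>k. cmod c * q ^ k)"
    using q by (intro summable_mult summable_geometric) auto
  then show "summable (\<lambda>i. norm (1 - c * complex_of_real q ^ i - 1))"
    using q by (simp add: norm_mult norm_power)
qed

lemma qpoch_tendsto_inf: "(\<lambda>n. qpoch c q n) \<longlonglongrightarrow> qpoch_inf c q"
  unfolding qpoch_def qpoch_inf_def
  by (rule has_prod_imp_tendsto'[OF convergent_prod_has_prod[OF convergent_prod_qpoch]])

lemma qpoch_inf_shift: "qpoch_inf c q = (1 - c) * qpoch_inf (c * of_real q) q"
proof (rule LIMSEQ_unique)
  show "(\<lambda>n. qpoch c q (Suc n)) \<longlonglongrightarrow> qpoch_inf c q"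
    using qpoch_tendsto_inf by (rule LIMSEQ_Suc)
  show "(\<lambda>n. qpoch c q (Suc n)) \<longlonglongrightarrow> (1 - c) * qpoch_inf (c * of_real q) q"
    unfolding qpoch_Suc_shift by (intro tendsto_intros qpoch_tendsto_inf)
qed

lemma qpoch_inf_split: "qpoch_inf c q = qpoch c q n * qpoch_inf (c * of_real q ^ n) q"
proof (induction n)
  case (Suc n)
  then show ?case
    by (simp add: qpoch_Suc mult.assoc qpoch_inf_shift[of "c * of_real q ^ n"] mult_ac)
qed auto

lemma one_minus_qpow_nonzero: "cmod c < 1 \<Longrightarrow> 1 - c * of_real q ^ k \<noteq> 0"
proof
  assume "cmod c < 1" "1 - c * of_real q ^ k = 0"
  then have "1 = cmod c * q ^ k" using q
    by (metis abs_of_pos eq_iff_diff_eq_0 norm_mult norm_of_real norm_one norm_power)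
  moreover have "cmod c * q ^ k \<le> cmod c" 
    using q by (intro mult_right_le_one_le) (auto simp: power_le_one)
  ultimately show False using \<open>cmod c < 1\<close> by simp
qed

text \<open>A convergent product vanishes only if one of its factors does.\<close>

lemma qpoch_inf_nonzero: "cmod c < 1 \<Longrightarrow> qpoch_inf c q \<noteq> 0"
  unfolding qpoch_inf_def
  by (rule prodinf_nonzero[OF convergent_prod_qpoch one_minus_qpow_nonzero])

lemma qpoch_nonzero: "cmod c < 1 \<Longrightarrow> qpoch c q n \<noteq> 0"
  using one_minus_qpow_nonzero by (simp add: qpoch_def)

text \<open>On every disc around 0 the product is a uniform limit of polynomials, and these discs
  exhaust the plane.\<close>

lemma holomorphic_qpoch_inf_UNIV: "(\<lambda>c. qpoch_inf c q) holomorphic_on UNIV"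
proof -
  have "(\<lambda>c. qpoch_inf c q) holomorphic_on ball 0 R" for R
  proof -
    have "uniform_limit (cball 0 R) (\<lambda>n c. qpoch c q n) (\<lambda>c. qpoch_inf c q) sequentially"
      using uniformly_convergent_qpoch[of R] limI[OF qpoch_tendsto_inf]
      by (simp add: uniformly_convergent_uniform_limit_iff)
    then show ?thesis
      by (rule holomorphic_uniform_limit[rotated])
         (auto simp: qpoch_def intro!: always_eventually continuous_intros holomorphic_intros)
  qed
  then have "(\<lambda>c. qpoch_inf c q) holomorphic_on (\<Union>R. ball 0 R)"
    by (subst holomorphic_on_UN_open) auto
  moreover have "(\<Union>R. ball 0 R) = (UNIV :: complex set)"
    by (auto intro: gt_ex)
  ultimately show ?thesis by simp
qed

lemma holomorphic_qpoch_inf [holomorphic_intros]: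
  "f holomorphic_on A \<Longrightarrow> (\<lambda>z. qpoch_inf (f z) q) holomorphic_on A"
  using holomorphic_on_compose_gen[OF _ holomorphic_qpoch_inf_UNIV, of f A] by (simp add: o_def)

lemma continuous_on_qpoch_inf [continuous_intros]:
  "continuous_on A f \<Longrightarrow> continuous_on A (\<lambda>z. qpoch_inf (f z) q)"
  using continuous_on_compose2[OF holomorphic_on_imp_continuous_on[OF holomorphic_qpoch_inf_UNIV], of A f]
  by simp

lemma qpoch_inf_bounded:
  obtains M where "M > 0" "\<And>c. cmod c \<le> R \<Longrightarrow> cmod (qpoch_inf c q) \<le> M"
proof -
  have "compact ((\<lambda>c. qpoch_inf c q) ` cball 0 R)"
    by (intro compact_continuous_image continuous_intros) auto
  then obtain M where "M > 0" "\<forall>x\<in>(\<lambda>c. qpoch_inf c q) ` cball 0 R. norm x \<le> M"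
    using compact_imp_bounded bounded_pos by blast
  then show ?thesis using that by auto
qed

text \<open>The condition \<open>R < 1\<close> keeps the compact disc away from the zeros of the
  product, the nearest of which is 1.\<close>

lemma inverse_qpoch_inf_bounded:
  assumes "R < 1"
  obtains M where "M > 0" "\<And>c. cmod c \<le> R \<Longrightarrow> cmod (inverse (qpoch_inf c q)) \<le> M"
proof -
  have "compact ((\<lambda>c. inverse (qpoch_inf c q)) ` cball 0 R)"
    using assms by (intro compact_continuous_image continuous_intros ballI qpoch_inf_nonzero) auto
  then obtain M where "M > 0" "\<forall>x\<in>(\<lambda>c. inverse (qpoch_inf c q)) ` cball 0 R. norm x \<le> M"
    using compact_imp_bounded bounded_pos by blast
  then show ?thesis using that by auto
qed

section \<open>The q-binomial transform\<close>

text \<open>The finite q-binomial theorem, by induction on \<open>k\<close> through a Pascal-type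
  rule for the coefficients.\<close>

lemma qbinomial_sum:
  "(\<Sum>n\<le>k. qpoch (1 / of_real q ^ k) q n / qpoch (of_real q) q n * z ^ n)
     = (\<Prod>j<k. 1 - z / of_real q ^ Suc j)"
proof (induction k)
  case (Suc k)
  let ?Q = "complex_of_real q"
  define c where "c k n = qpoch (1 / ?Q ^ k) q n / qpoch ?Q q n" for k n
  have nz: "qpoch ?Q q n \<noteq> 0" for n using q by (intro qpoch_nonzero) auto
  have Qnz: "?Q \<noteq> 0" using q by auto
  have pw: "1 - ?Q * ?Q ^ n \<noteq> 0" for n using one_minus_qpow_nonzero[of ?Q n] q by simp
  have c0: "c k 0 = 1" for k by (simp add: c_def)
  \<comment> \<open>The coefficient just above the degree contains the factor
    \<open>1 - ?Q ^ k / ?Q ^ k\<close>.\<close>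
  have ck: "c k (Suc k) = 0" for k
    using Qnz by (simp add: c_def qpoch_Suc)
  \<comment> \<open>This is the comparison of coefficients when the polynomial for \<open>k\<close>
    is multiplied by the new factor \<open>1 - z / ?Q ^ Suc k\<close>.\<close>
  have rec: "c (Suc k) (Suc n) = c k (Suc n) - c k n / ?Q ^ Suc k" for n
  proof -
    have "qpoch (1 / ?Q ^ Suc k) q (Suc n) = (1 - 1 / ?Q ^ Suc k) * qpoch (1 / ?Q ^ k) q n"
      using Qnz by (subst qpoch_Suc_shift) simp
    then have "c (Suc k) (Suc n) = (1 - 1 / ?Q ^ Suc k) / (1 - ?Q * ?Q ^ n) * c k n"
      using nz pw by (simp add: c_def qpoch_Suc field_simps)
    moreover have "c k (Suc n) = (1 - ?Q ^ n / ?Q ^ k) / (1 - ?Q * ?Q ^ n) * c k n"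
      using nz pw by (simp add: c_def qpoch_Suc field_simps)
    moreover have "(1 - 1 / ?Q ^ Suc k) / (1 - ?Q * ?Q ^ n)
       = (1 - ?Q ^ n / ?Q ^ k) / (1 - ?Q * ?Q ^ n) - 1 / ?Q ^ Suc k"
      using pw[of n] Qnz by (simp add: field_simps)
    ultimately show ?thesis by (simp only: left_diff_distrib) simp
  qed
  have "(\<Sum>n\<le>Suc k. c (Suc k) n * z ^ n) = 1 + (\<Sum>n\<le>k. c (Suc k) (Suc n) * z ^ Suc n)"
    by (subst sum.atMost_Suc_shift) (simp add: c0)
  also have "\<dots> = 1 + (\<Sum>n\<le>k. c k (Suc n) * z ^ Suc n) - z / ?Q ^ Suc k * (\<Sum>n\<le>k. c k n * z ^ n)"
    unfolding rec sum_distrib_left left_diff_distrib sum_subtractf by (simp add: mult_ac)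
  also have "1 + (\<Sum>n\<le>k. c k (Suc n) * z ^ Suc n) = (\<Sum>n\<le>Suc k. c k n * z ^ n)"
    by (subst sum.atMost_Suc_shift) (simp add: c0)
  also have "\<dots> = (\<Sum>n\<le>k. c k n * z ^ n)" by (simp add: ck)
  also have "(\<Sum>n\<le>k. c k n * z ^ n) - z / ?Q ^ Suc k * (\<Sum>n\<le>k. c k n * z ^ n)
     = (\<Prod>j<Suc k. 1 - z / ?Q ^ Suc j)"
    unfolding Suc[folded c_def] by (simp add: algebra_simps)
  finally show ?case by (simp add: c_def)
qed simp

text \<open>In the Taylor series of \<open>f\<close>, the transform multiplies the coefficient of
  degree \<open>m\<close> by a product that is 0 for \<open>m < k\<close> and lies between 0 and 1
  otherwise. Cauchy's estimate on the circle of radius \<open>1 / r\<close> then leaves the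
  geometric tail of \<open>B * r ^ m\<close> from \<open>m = k\<close> on.\<close>

lemma qbinomial_transform_bound:
  fixes f :: "complex \<Rightarrow> complex"
  assumes f: "f holomorphic_on ball 0 R" and r: "0 < r" "r < 1" "1 / r < R"
    and B: "\<And>z. cmod z = 1 / r \<Longrightarrow> cmod (f z) \<le> B"
  shows "cmod (\<Sum>n\<le>k. qpoch (1 / of_real q ^ k) q n / qpoch (of_real q) q n * of_real q ^ n
                  * f (of_real q ^ n)) \<le> B / (1 - r) * r ^ k"
proof -
  let ?Q = "complex_of_real q"
  define u where "u m = (deriv ^^ m) f 0 / fact m" for m
  define c where "c n = qpoch (1 / ?Q ^ k) q n / qpoch ?Q q n * ?Q ^ n" for n
  have ub: "cmod (u m) \<le> B * r ^ m" for m
  proof -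
    have "cmod ((deriv ^^ m) f 0) \<le> fact m * B / (1 / r) ^ m"
      using r B
      by (intro Cauchy_inequality holomorphic_on_subset[OF f] 
            continuous_on_subset[OF holomorphic_on_imp_continuous_on[OF f]]) auto
    then show ?thesis by (simp add: u_def norm_divide field_simps power_divide)
  qed
  have sums: "(\<lambda>m. u m * (?Q ^ n) ^ m) sums f (?Q ^ n)" for n
  proof -
    have "1 < R" using r by (smt (verit) less_divide_eq_1_pos)
    moreover have "cmod (?Q ^ n) \<le> 1" using q by (simp add: norm_power power_le_one)
    ultimately have "?Q ^ n \<in> ball 0 R" by auto
    from holomorphic_power_series[OF f this] show ?thesis by (simp add: u_def)
  qed
  have "(\<lambda>m. \<Sum>n\<le>k. c n * (u m * (?Q ^ n) ^ m)) sums (\<Sum>n\<le>k. c n * f (?Q ^ n))"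
    by (intro sums_sum sums_mult sums)
  \<comment> \<open>The q-binomial polynomial is evaluated at \<open>?Q ^ Suc m\<close> rather than
    \<open>?Q ^ m\<close> because \<open>c n\<close> includes the weight
    \<open>?Q ^ n\<close>.\<close>
  moreover have "(\<Sum>n\<le>k. c n * (u m * (?Q ^ n) ^ m)) = u m * (\<Prod>j<k. 1 - ?Q ^ Suc m / ?Q ^ Suc j)" for m
    unfolding qbinomial_sum[symmetric] sum_distrib_left c_def
    by (intro sum.cong refl) (simp add: power_mult[symmetric] power_add algebra_simps)
  ultimately have S: "(\<lambda>m. u m * (\<Prod>j<k. 1 - ?Q ^ Suc m / ?Q ^ Suc j)) sums (\<Sum>n\<le>k. c n * f (?Q ^ n))"
    by simp
  have B0: "0 \<le> B" using B[of "of_real (1 / r)"] r by (smt (verit) norm_ge_zero norm_of_real divide_pos_pos)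
  \<comment> \<open>The factor with \<open>j = m\<close> is zero.\<close>
  have z: "u m * (\<Prod>j<k. 1 - ?Q ^ Suc m / ?Q ^ Suc j) = 0" if "m < k" for m
    using that q by (auto intro!: bexI[of _ m])
  have le: "cmod (u (m + k) * (\<Prod>j<k. 1 - ?Q ^ Suc (m + k) / ?Q ^ Suc j)) \<le> B * r ^ k * r ^ m" for m
  proof -
    have "cmod (\<Prod>j<k. 1 - ?Q ^ Suc (m + k) / ?Q ^ Suc j) \<le> 1"
      unfolding prod_norm[symmetric]
    proof (rule prod_le_1, safe)
      fix j assume "j < k"
      then have "?Q ^ Suc (m + k) / ?Q ^ Suc j = of_real (q ^ (m + k - j))"
        using q by (simp add: power_diff)
      then have "1 - ?Q ^ Suc (m + k) / ?Q ^ Suc j = of_real (1 - q ^ (m + k - j))" by simp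
      then show "cmod (1 - ?Q ^ Suc (m + k) / ?Q ^ Suc j) \<le> 1" 
        using q by (simp only: norm_of_real) (auto simp: power_le_one)
    qed auto
    then have "cmod (u (m + k) * (\<Prod>j<k. 1 - ?Q ^ Suc (m + k) / ?Q ^ Suc j)) \<le> (B * r ^ (m + k)) * 1"
      unfolding norm_mult using ub B0 r by (intro mult_mono) auto
    then show ?thesis by (simp add: power_add mult_ac)
  qed
  have gs: "(\<lambda>m. B * r ^ k * r ^ m) sums (B * r ^ k * (1 / (1 - r)))"
    using r by (intro sums_mult geometric_sums) auto
  have S': "(\<lambda>m. u (m + k) * (\<Prod>j<k. 1 - ?Q ^ Suc (m + k) / ?Q ^ Suc j)) sums (\<Sum>n\<le>k. c n * f (?Q ^ n))"
    using S z by (subst sums_zero_iff_shift) auto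
  have "cmod (\<Sum>n\<le>k. c n * f (?Q ^ n)) \<le> B * r ^ k * (1 / (1 - r))"
    using norm_suminf_le[OF le sums_summable[OF gs]] sums_unique[OF S'] sums_unique[OF gs] by simp
  then show ?thesis by (simp add: c_def)
qed

end

section \<open>The Askey--Wilson integral\<close>

text \<open>Up to the factor \<open>\<i>\<close>, the mean is the contour integral of
  \<open>f z / z\<close>. The two circles are homotopic along radial segments inside the annulus,
  which omits 0 because \<open>0 \<le> m\<close>.\<close>

lemma integral_circle_radius_eq:
  assumes f: "f holomorphic_on {z. m < cmod z \<and> cmod z < M}"
    and r: "0 \<le> m" "m < r" "r \<le> s" "s < M"
  shows "integral {-pi..pi} (\<lambda>t. f (of_real r * cis t)) = integral {-pi..pi} (\<lambda>t. f (of_real s * cis t))"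
proof -
  let ?A = "{z. m < cmod z \<and> cmod z < M}"
  let ?c = "\<lambda>r. part_circlepath 0 r (-pi) pi"
  have "open ?A"
    by (intro open_Collect_conj open_Collect_less continuous_intros)
  have "homotopic_loops ?A (?c r) (?c s)"
  proof (rule homotopic_loops_linear)
    fix t :: real assume "t \<in> {0..1}"
    define e where "e = exp (\<i> * of_real (linepath (-pi) pi t))"
    have e: "cmod e = 1" by (simp add: e_def)
    have p: "?c r t = of_real r * e" for r
      by (simp add: part_circlepath_def e_def of_real_linepath)
    show "closed_segment (?c r t) (?c s t) \<subseteq> ?A"
    proof
      fix x assume "x \<in> closed_segment (?c r t) (?c s t)"
      then obtain u where u: "0 \<le> u" "u \<le> 1" and x: "x = (1 - u) *\<^sub>R (of_real r * e) + u *\<^sub>R (of_real s * e)"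
        by (auto simp: closed_segment_def p)
      have "x = of_real ((1 - u) * r + u * s) * e"
        by (simp add: x scaleR_conv_of_real algebra_simps)
      moreover have "(1 - u) * r + u * s = r + u * (s - r)" by (simp add: algebra_simps)
      moreover have "0 \<le> u * (s - r)" "u * (s - r) \<le> s - r"
        using u r by (auto intro: mult_left_le_one_le)
      moreover have "cmod x = \<bar>(1 - u) * r + u * s\<bar>"
        unfolding calculation(1) norm_mult e by (simp only: norm_of_real mult_1_right)
      ultimately show "x \<in> ?A" using r by simp
    qed
  qed (auto simp: exp_minus)
  then have "contour_integral (?c r) (\<lambda>z. f z / z) = contour_integral (?c s) (\<lambda>z. f z / z)"
    by (rule Cauchy_theorem_homotopic_loops[OF _ \<open>open ?A\<close>])
       (use r in \<open>auto intro!: holomorphic_intros f\<close>)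
  moreover have "contour_integral (?c r) (\<lambda>z. f z / z) = \<i> * integral {-pi..pi} (\<lambda>t. f (of_real r * cis t))"
    if "r > 0" for r
    using that by (subst contour_integral_part_circlepath_eq)
      (auto simp: mult_ac intro!: integral_cong simp flip: integral_mult_right)
  ultimately show ?thesis using r by simp
qed

section \<open>The Askey-Wilson weight and its first moment\<close>

text \<open>At \<open>z = cis t\<close> this is h(cos t; a). The complex variable \<open>z\<close>
  makes contour shifts possible.\<close>

definition aw_den :: "real \<Rightarrow> complex \<Rightarrow> complex \<Rightarrow> complex" where
  "aw_den q a z = qpoch_inf (a * z) q * qpoch_inf (a / z) q"

definition aw_weight :: "real \<Rightarrow> complex \<Rightarrow> complex \<Rightarrow> complex \<Rightarrow> complex \<Rightarrow> complex \<Rightarrow> complex" where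
  "aw_weight q a b c d z = aw_den q 1 (z ^ 2) / (aw_den q a z * aw_den q b z * aw_den q c z * aw_den q d z)"

text \<open>The numerator is arranged so that \<^term>\<open>aw_shift q a b c d z + aw_shift q a b c d (1 / z)\<close> is the
  Askey--Wilson weight times a polynomial of degree one in \<^term>\<open>z + 1 / z\<close>, while passing from
  \<^term>\<open>z\<close> to \<^term>\<open>z / of_real q\<close> amounts to inverting \<^term>\<open>z\<close> and changing the sign.\<close>

definition aw_shift :: "real \<Rightarrow> complex \<Rightarrow> complex \<Rightarrow> complex \<Rightarrow> complex \<Rightarrow> complex \<Rightarrow> complex" where
  "aw_shift q a b c d z = qpoch_inf (of_real q * z ^ 2) q * qpoch_inf (1 / z ^ 2) q /
     (z * (qpoch_inf (of_real q * a * z) q * qpoch_inf (a / z) q)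
        * (qpoch_inf (of_real q * b * z) q * qpoch_inf (b / z) q)
        * (qpoch_inf (of_real q * c * z) q * qpoch_inf (c / z) q)
        * (qpoch_inf (of_real q * d * z) q * qpoch_inf (d / z) q))"

definition aw_int :: "real \<Rightarrow> complex \<Rightarrow> complex \<Rightarrow> complex \<Rightarrow> complex \<Rightarrow> complex" where
  "aw_int q a b c d = integral {0..pi} (\<lambda>t. aw_weight q a b c d (cis t))"

text \<open>With \<open>w = 1 / z\<close> both sides are divisible by \<open>z - w\<close>, since
  \<open>1 - z^2 = z * (w - z)\<close> and \<open>1 - w^2 = w * (z - w)\<close>. In terms of the
  elementary symmetric functions of the parameters, the \<open>e2\<close> terms cancel on the right,
  and the remaining difference yields a second factor \<open>w - z\<close>.\<close>

lemma aw_polynomial_identity: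
  fixes z w :: complex
  assumes "z * w = 1"
  shows "(1 - z^2) * (1 - w^2) * ((1 - a*b*c*d) * (z + w) - (a + b + c + d - (a*b*c + a*b*d + a*c*d + b*c*d)))
    = w * (1 - w^2) * ((1 - a*z) * (1 - b*z) * (1 - c*z) * (1 - d*z))
      + z * (1 - z^2) * ((1 - a*w) * (1 - b*w) * (1 - c*w) * (1 - d*w))"
proof -
  define e2 e4 where "e2 = a*b + a*c + a*d + b*c + b*d + c*d" and "e4 = a*b*c*d"
  define e1 e3 where "e1 = a + b + c + d" and "e3 = a*b*c + a*b*d + a*c*d + b*c*d"
  have expand: "w^2 * ((1 - a*z) * (1 - b*z) * (1 - c*z) * (1 - d*z)) = w^2 - e1 * w + e2 - e3 * z + e4 * z^2"
    if "z * w = 1" for z w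
  proof -
    have "(1 - a*z) * (1 - b*z) * (1 - c*z) * (1 - d*z) = 1 - e1 * z + e2 * z^2 - e3 * z^3 + e4 * z^4"
      unfolding e1_def e2_def e3_def e4_def
      by (simp add: algebra_simps power2_eq_square power3_eq_cube power4_eq_xxxx)
    moreover have "w^2 * z = w" "w^2 * z^2 = 1" "w^2 * z^3 = z" "w^2 * z^4 = z^2"
      using that by algebra+
    ultimately show ?thesis by algebra
  qed
  have z: "1 - z^2 = z * (w - z)" and w: "1 - w^2 = w * (z - w)"
    using assms by algebra+
  have "(1 - z^2) * (1 - w^2) * ((1 - e4) * (z + w) - (e1 - e3))
      = (z - w) * (w^2 - e1 * w + e2 - e3 * z + e4 * z^2) + (w - z) * (z^2 - e1 * z + e2 - e3 * w + e4 * w^2)"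
    unfolding z w using assms by algebra
  also have "\<dots> = w * (1 - w^2) * ((1 - a*z) * (1 - b*z) * (1 - c*z) * (1 - d*z))
      + z * (1 - z^2) * ((1 - a*w) * (1 - b*w) * (1 - c*w) * (1 - d*w))"
    \<comment> \<open>The expansion is used twice, the second time with \<open>z\<close> and
      \<open>w\<close> exchanged.\<close>
    unfolding expand[OF assms, symmetric] expand[of w z, unfolded mult.commute[of w z], OF assms, symmetric] z w
    by (simp add: power2_eq_square mult_ac)
  finally show ?thesis by (simp add: e1_def e3_def e4_def)
qed

context
  fixes q :: real
  assumes q: "0 < q" "q < 1"
begin

lemma qpoch_inf_shift': "qpoch_inf (of_real q * c) q = qpoch_inf c q / (1 - c)" if "c \<noteq> 1"
  using that qpoch_inf_shift[OF q, of c] by (simp add: mult_ac)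

lemma cmod_qmult_less: "cmod c < 1 \<Longrightarrow> cmod (of_real q * c) < 1"
  using q mult_strict_mono[of q 1 "cmod c" 1] by (simp add: norm_mult)

lemma aw_den_nonzero: "cmod a < 1 \<Longrightarrow> cmod z = 1 \<Longrightarrow> aw_den q a z \<noteq> 0"
  by (simp add: aw_den_def norm_mult norm_divide qpoch_inf_nonzero[OF q])

lemma aw_den_qmult:
  assumes "cmod a < 1" "cmod z = 1"
  shows "aw_den q (a * of_real q) z = aw_den q a z / ((1 - a * z) * (1 - a / z))"
proof -
  have "cmod (a * z) < 1" "cmod (a / z) < 1" using assms by (auto simp: norm_mult norm_divide)
  then have "a * z \<noteq> 1" "a / z \<noteq> 1" by (metis norm_one less_irrefl)+
  then show ?thesis
    using qpoch_inf_shift'[of "a * z"] qpoch_inf_shift'[of "a / z"] by (simp add: aw_den_def mult_ac)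
qed

lemma continuous_on_aw_den:
  "continuous_on A f \<Longrightarrow> continuous_on A g \<Longrightarrow> (\<And>x. x \<in> A \<Longrightarrow> g x \<noteq> 0) \<Longrightarrow>
     continuous_on A (\<lambda>x. aw_den q (f x) (g x))"
  unfolding aw_den_def by (intro continuous_intros continuous_on_qpoch_inf[OF q]) auto

context
  fixes a b c d :: complex
  assumes abcd: "cmod a < 1" "cmod b < 1" "cmod c < 1" "cmod d < 1"
begin

lemma continuous_on_aw_weight: "continuous_on A (\<lambda>t. aw_weight q a b c d (cis t))"
  unfolding aw_weight_def
  by (intro continuous_intros continuous_on_aw_den) (auto simp: aw_den_nonzero abcd)

text \<open>The denominator factors belonging to \<open>a\<close> can vanish only for
  \<open>cmod z \<le> cmod a\<close> or \<open>cmod z \<ge> 1 / (q * cmod a)\<close>, and likewise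
  for \<open>b\<close>, \<open>c\<close>, \<open>d\<close>; the annulus avoids all these
  regions.\<close>

lemma aw_shift_holomorphic:
  assumes m: "cmod a \<le> m" "cmod b \<le> m" "cmod c \<le> m" "cmod d \<le> m" "0 < m"
  shows "aw_shift q a b c d holomorphic_on {z. m < cmod z \<and> cmod z < 1 / (q * m)}"
proof -
  have nz: "qpoch_inf (of_real q * a * z) q \<noteq> 0" "qpoch_inf (a / z) q \<noteq> 0"
    if "cmod a \<le> m" "m < cmod z" "cmod z < 1 / (q * m)" for a z
  proof -
    have "q * (cmod a * cmod z) \<le> q * (m * cmod z)"
      using that q by (intro mult_left_mono mult_right_mono) auto
    also have "\<dots> < 1" using that m q by (simp add: field_simps)
    finally show "qpoch_inf (of_real q * a * z) q \<noteq> 0"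
      using q by (intro qpoch_inf_nonzero[OF q]) (simp add: norm_mult mult_ac)
    show "qpoch_inf (a / z) q \<noteq> 0"
      using that m by (intro qpoch_inf_nonzero[OF q]) (simp add: norm_divide divide_simps)
  qed
  have hol: "(\<lambda>z. qpoch_inf (of_real q * a * z) q) holomorphic_on A" "(\<lambda>z. qpoch_inf (of_real q * z^2) q) holomorphic_on A"
    "(\<lambda>z. z) holomorphic_on A" for a A
    by (intro holomorphic_intros holomorphic_qpoch_inf[OF q])+
  have hol': "(\<lambda>z. qpoch_inf (a / z) q) holomorphic_on {z. m < cmod z \<and> cmod z < 1 / (q * m)}"
    "(\<lambda>z. qpoch_inf (1 / z^2) q) holomorphic_on {z. m < cmod z \<and> cmod z < 1 / (q * m)}" for a
    by (intro holomorphic_intros holomorphic_qpoch_inf[OF q]; use m in force)+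
  show ?thesis
    unfolding aw_shift_def[abs_def]
    by (intro holomorphic_on_divide holomorphic_on_mult hol hol') (use m nz in auto)
qed

text \<open>Because \<open>m < 1\<close>, the annulus contains both the unit circle and the circle
  of radius \<open>1 / q\<close>.\<close>

lemma aw_shift_holomorphic_annulus:
  obtains m where "0 < m" "m < 1" "aw_shift q a b c d holomorphic_on {z. m < cmod z \<and> cmod z < 1 / (q * m)}"
proof
  \<comment> \<open>The entry \<open>1 / 2\<close> keeps \<open>m\<close> positive when all four
    parameters are 0.\<close>
  define m where "m = Max {cmod a, cmod b, cmod c, cmod d, 1 / 2}"
  have "1 / 2 \<le> m" by (simp add: m_def)
  then show "0 < m" by simp
  show "m < 1" using abcd by (simp add: m_def)
  show "aw_shift q a b c d holomorphic_on {z. m < cmod z \<and> cmod z < 1 / (q * m)}"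
    by (rule aw_shift_holomorphic) (simp_all add: m_def)
qed

lemma continuous_on_aw_shift: "continuous_on A (\<lambda>t. aw_shift q a b c d (cis t))"
proof -
  obtain m where m: "0 < m" "m < 1" "aw_shift q a b c d holomorphic_on {z. m < cmod z \<and> cmod z < 1 / (q * m)}"
    by (rule aw_shift_holomorphic_annulus)
  then have "q * m < 1" using q by (smt (verit) mult_less_cancel_right2)
  then show ?thesis
    using m q by (intro continuous_on_compose2[OF holomorphic_on_imp_continuous_on[OF m(3)]] continuous_intros)
      auto
qed

text \<open>Replacing \<open>z\<close> by \<open>z / q\<close> turns the arguments
  \<open>q * a * z\<close> and \<open>a / z\<close> into \<open>a * z\<close> and
  \<open>q * a / z\<close>, which are those at \<open>1 / z\<close> in the other order. Hence the
  parameters cancel from the ratio, and the numerator and the prefactor \<open>1 / z\<close>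
  contribute -1.\<close>

lemma aw_shift_div_q:
  assumes z: "cmod z = 1"
  shows "aw_shift q a b c d (z / of_real q) = - aw_shift q a b c d (1 / z)"
proof -
  let ?Q = "complex_of_real q"
  have Q: "?Q \<noteq> 0" "z \<noteq> 0" using q z by auto
  define y where "y = z ^ 2 / ?Q"
  have y: "y \<noteq> 0" "1 / y \<noteq> 1"
  proof -
    have "cmod (1 / y) = q" using z q by (simp add: y_def norm_divide norm_power)
    then show "1 / y \<noteq> 1" using q by (metis norm_one less_irrefl)
    show "y \<noteq> 0" using Q by (simp add: y_def)
  qed
  have 1: "qpoch_inf (?Q * (z / ?Q) ^ 2) q = (1 - y) * qpoch_inf (z ^ 2) q"
    using qpoch_inf_shift[OF q, of y] Q by (simp add: y_def power2_eq_square mult_ac)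
  have 2: "qpoch_inf (1 / (z / ?Q) ^ 2) q = qpoch_inf (?Q * (1 / z) ^ 2) q / (1 - 1 / y)"
    using qpoch_inf_shift'[OF y(2)] Q by (simp add: y_def power2_eq_square mult_ac)
  have 3: "(1 - y) / (1 - 1 / y) = - y" using y by (simp add: divide_simps) (simp add: algebra_simps)
  have "aw_shift q a b c d (z / ?Q) = (1 - y) / (1 - 1 / y) * (?Q / z ^ 2)
     * (aw_shift q a b c d (1 / z))"
    unfolding aw_shift_def 1 2 using Q by (simp add: mult_ac power2_eq_square)
  also have "\<dots> = - aw_shift q a b c d (1 / z)"
    unfolding 3 using Q by (simp add: y_def)
  finally show ?thesis .
qed

text \<open>Moving the circle from radius 1 to \<open>1 / q\<close> and reflecting \<open>t\<close>
  shows that the integral equals its own negative.\<close>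

lemma integral_aw_shift: "integral {-pi..pi} (\<lambda>t. aw_shift q a b c d (cis t)) = 0"
proof -
  obtain m where m: "0 < m" "m < 1" "aw_shift q a b c d holomorphic_on {z. m < cmod z \<and> cmod z < 1 / (q * m)}"
    by (rule aw_shift_holomorphic_annulus)
  have "integral {-pi..pi} (\<lambda>t. aw_shift q a b c d (of_real 1 * cis t))
      = integral {-pi..pi} (\<lambda>t. aw_shift q a b c d (of_real (1 / q) * cis t))"
    by (rule integral_circle_radius_eq[OF m(3)]) (use m q in \<open>auto simp: field_simps\<close>)
  also have "\<dots> = integral {-pi..pi} (\<lambda>t. - aw_shift q a b c d (cis (- t)))"
    using aw_shift_div_q by (simp add: divide_simps cis_inverse flip: cis_inverse)
  also have "\<dots> = - integral {-pi..pi} (\<lambda>t. aw_shift q a b c d (cis t))"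
    using Henstock_Kurzweil_Integration.integral_reflect_real[where a="-pi" and b=pi and f="\<lambda>t. aw_shift q a b c d (cis t)"] by simp
  finally show ?thesis by simp
qed

text \<open>After first factors are split off, all three terms share the quotient
  \<open>X / PA\<close>; what is left is \<open>aw_polynomial_identity\<close> divided by the linear
  factors \<open>PL * PR\<close>.\<close>

lemma aw_weight_aw_shift:
  assumes z: "cmod z = 1"
  shows "aw_weight q a b c d z * 
      ((1 - a*b*c*d) * (z + 1 / z) - (a + b + c + d - (a*b*c + a*b*d + a*c*d + b*c*d)))
     = aw_shift q a b c d z + aw_shift q a b c d (1 / z)"
proof -
  let ?Q = "complex_of_real q"
  have "z \<noteq> 0" using z by auto
  define w where "w = 1 / z"
  have zw: "z * w = 1" "cmod w = 1" and zinv: "z = 1 / w"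
    using \<open>z \<noteq> 0\<close> z by (auto simp: w_def norm_divide)
  have div: "x / z = x * w" "x / w = x * z" for x by (simp_all add: w_def)
  define A where "A a = qpoch_inf (?Q * a * z) q * qpoch_inf (?Q * a * w) q" for a
  define L where "L a = 1 - a * z" for a
  define R where "R a = 1 - a * w" for a
  have s: "qpoch_inf x q = (1 - x) * qpoch_inf (?Q * x) q" for x
    using qpoch_inf_shift[OF q, of x] by (simp add: mult_ac)
  have nz: "A a \<noteq> 0" "L a \<noteq> 0" "R a \<noteq> 0" if "cmod a < 1" for a
  proof -
    have "cmod (a * z) < 1" "cmod (a * w) < 1" using that z zw by (auto simp: norm_mult)
    then show "L a \<noteq> 0" "R a \<noteq> 0" unfolding L_def R_def by (metis eq_iff_diff_eq_0 norm_one less_irrefl)+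
    show "A a \<noteq> 0"
      using cmod_qmult_less[OF \<open>cmod (a * z) < 1\<close>] cmod_qmult_less[OF \<open>cmod (a * w) < 1\<close>]
      by (simp add: A_def qpoch_inf_nonzero[OF q] mult.assoc)
  qed
  define PA PL PR where "PA = A a * A b * A c * A d" and "PL = L a * L b * L c * L d"
    and "PR = R a * R b * R c * R d"
  have nzP: "PA \<noteq> 0" "PL \<noteq> 0" "PR \<noteq> 0"
    using nz abcd by (simp_all add: PA_def PL_def PR_def)
  define X where "X = qpoch_inf (?Q * z^2) q * qpoch_inf (?Q * w^2) q"
  have den: "aw_den q a z = L a * R a * A a" for a
    using s[of "a * z"] s[of "a * w"] by (simp add: aw_den_def div A_def L_def R_def mult_ac)
  have num: "aw_den q 1 (z^2) = (1 - z^2) * (1 - w^2) * X"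
    using s[of "z^2"] s[of "w^2"] by (simp add: aw_den_def X_def w_def power_one_over mult_ac)
  have "qpoch_inf (?Q * a * z) q * qpoch_inf (a / z) q = R a * A a" for a
    using s[of "a * w"] by (simp add: div R_def A_def mult_ac)
  moreover have "qpoch_inf (1 / z^2) q = (1 - w^2) * qpoch_inf (?Q * w^2) q"
    using s[of "w^2"] by (simp add: w_def power_one_over)
  ultimately have sz: "aw_shift q a b c d z = w * (1 - w^2) * X / (PR * PA)"
    by (simp add: aw_shift_def X_def PR_def PA_def w_def mult_ac)
  have "qpoch_inf (?Q * a * w) q * qpoch_inf (a / w) q = L a * A a" for a
    using s[of "a * z"] by (simp add: div L_def A_def mult_ac)
  moreover have "qpoch_inf (1 / w^2) q = (1 - z^2) * qpoch_inf (?Q * z^2) q"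
    using s[of "z^2"] by (simp add: w_def power_one_over)
  ultimately have sw: "aw_shift q a b c d w = z * (1 - z^2) * X / (PL * PA)"
    by (simp add: aw_shift_def X_def PL_def PA_def zinv[symmetric] mult_ac) (simp add: w_def mult_ac)
  define E where "E = (1 - a*b*c*d) * (z + w) - (a + b + c + d - (a*b*c + a*b*d + a*c*d + b*c*d))"
  have id: "(1 - z^2) * (1 - w^2) * E = w * (1 - w^2) * PL + z * (1 - z^2) * PR"
    unfolding E_def PL_def PR_def L_def R_def by (rule aw_polynomial_identity[OF zw(1)])
  have W: "aw_weight q a b c d z = (1 - z^2) * (1 - w^2) * X / (PL * PR * PA)"
    unfolding aw_weight_def num den PL_def PR_def PA_def by (simp only: mult_ac)
  have "aw_weight q a b c d z * E = ((1 - z^2) * (1 - w^2) * E) * X / (PL * PR * PA)"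
    unfolding W by simp
  also have "\<dots> = aw_shift q a b c d z + aw_shift q a b c d w"
    unfolding id sz sw using nzP by (simp add: add_divide_distrib distrib_right mult.assoc)
  finally show ?thesis by (simp add: E_def w_def)
qed

text \<open>Folding the vanishing integral of \<open>aw_shift\<close> over \<open>{-pi..pi}\<close>
  onto \<open>{0..pi}\<close> adds the values at \<open>z\<close> and \<open>1 / z\<close>, which
  \<open>aw_weight_aw_shift\<close> evaluates.\<close>

lemma aw_first_moment:
  "integral {0..pi} (\<lambda>t. aw_weight q a b c d (cis t) *
     ((1 - a*b*c*d) * (cis t + 1 / cis t) - (a + b + c + d - (a*b*c + a*b*d + a*c*d + b*c*d)))) = 0"
proof -
  let ?G = "\<lambda>t. aw_shift q a b c d (cis t)"
  have int: "?G integrable_on {u..v}" for u v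
    by (intro integrable_continuous_real continuous_on_aw_shift)
  have int': "(\<lambda>t. ?G (- t)) integrable_on {0..pi}"
    using int[of "-pi" 0] Henstock_Kurzweil_Integration.integrable_reflect_real[where f="?G" and a="-pi" and b=0] by simp
  have "integral {0..pi} (\<lambda>t. aw_weight q a b c d (cis t) *
     ((1 - a*b*c*d) * (cis t + 1 / cis t) - (a + b + c + d - (a*b*c + a*b*d + a*c*d + b*c*d))))
    = integral {0..pi} (\<lambda>t. ?G t + ?G (- t))"
    by (intro integral_cong, subst aw_weight_aw_shift) (auto simp: divide_simps simp flip: cis_inverse)
  also have "\<dots> = integral {0..pi} ?G + integral {0..pi} (\<lambda>t. ?G (- t))"
    using int int' by (rule integral_add)
  also have "integral {0..pi} (\<lambda>t. ?G (- t)) = integral {-pi..0} ?G"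
    using Henstock_Kurzweil_Integration.integral_reflect_real[where a="-pi" and b=0 and f="?G"] by simp
  also have "integral {0..pi} ?G + integral {-pi..0} ?G = integral {-pi..pi} ?G"
    using Henstock_Kurzweil_Integration.integral_combine[of "-pi" 0 pi ?G] int by (simp add: add.commute)
  finally show ?thesis by (simp add: integral_aw_shift)
qed

text \<open>Passing from \<open>a\<close> to \<open>a * q\<close> multiplies the weight by
  \<open>(1 - a * z) * (1 - a / z)\<close>, which has degree one in \<open>z + 1 / z\<close>. Times
  \<open>1 - a*b*c*d\<close> it is a constant minus \<open>a\<close> times the polynomial of
  \<open>aw_first_moment\<close>, so only the constant survives integration.\<close>

lemma aw_int_recurrence:
  "(1 - a*b*c*d) * aw_int q (a * of_real q) b c d = (1 - a*b) * (1 - a*c) * (1 - a*d) * aw_int q a b c d"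
proof -
  let ?W = "\<lambda>t. aw_weight q a b c d (cis t)"
  let ?E = "\<lambda>z. (1 - a*b*c*d) * (z + 1 / z) - (a + b + c + d - (a*b*c + a*b*d + a*c*d + b*c*d))"
  have pt: "(1 - a*b*c*d) * aw_weight q (a * of_real q) b c d (cis t)
      = (1 - a*b) * (1 - a*c) * (1 - a*d) * ?W t - a * (?W t * ?E (cis t))" for t
  proof -
    define z w where "z = cis t" and "w = 1 / z"
    have zw: "z * w = 1" by (simp add: z_def w_def)
    have "aw_weight q (a * of_real q) b c d z = (1 - a * z) * (1 - a * w) * aw_weight q a b c d z"
      using aw_den_qmult[of a z] abcd by (simp add: aw_weight_def z_def w_def)
    moreover have "(1 - a*b*c*d) * ((1 - a*z) * (1 - a*w)) = (1 - a*b) * (1 - a*c) * (1 - a*d)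
         - a * ((1 - a*b*c*d) * (z + w) - (a + b + c + d - (a*b*c + a*b*d + a*c*d + b*c*d)))"
    proof -
      have "(1 - a*z) * (1 - a*w) = 1 + a^2 - a * (z + w)" using zw by algebra
      then show ?thesis by (simp only:) (simp add: algebra_simps power2_eq_square)
    qed
    ultimately have "(1 - a*b*c*d) * aw_weight q (a * of_real q) b c d z = ((1 - a*b) * (1 - a*c) * (1 - a*d)
         - a * ((1 - a*b*c*d) * (z + w) - (a + b + c + d - (a*b*c + a*b*d + a*c*d + b*c*d)))) * aw_weight q a b c d z"
      by (metis mult.assoc)
    moreover have "(K - a * E) * W = K * W - a * (W * E)" for K E W :: complex
      by (simp add: algebra_simps)
    ultimately show ?thesis by (simp only: z_def w_def)
  qed
  have W: "?W integrable_on {0..pi}" 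
    by (intro integrable_continuous_real continuous_on_aw_weight)
  have WE: "(\<lambda>t. ?W t * ?E (cis t)) integrable_on {0..pi}" 
    by (intro integrable_continuous_real continuous_intros continuous_on_aw_weight) auto
  have "(1 - a*b*c*d) * aw_int q (a * of_real q) b c d
     = integral {0..pi} (\<lambda>t. (1 - a*b) * (1 - a*c) * (1 - a*d) * ?W t - a * (?W t * ?E (cis t)))"
    unfolding aw_int_def pt[symmetric] by simp
  also have "\<dots> = integral {0..pi} (\<lambda>t. (1 - a*b) * (1 - a*c) * (1 - a*d) * ?W t)
       - integral {0..pi} (\<lambda>t. a * (?W t * ?E (cis t)))"
    using W WE by (intro integral_diff integrable_on_mult_right)
  also have "\<dots> = (1 - a*b) * (1 - a*c) * (1 - a*d) * aw_int q a b c d"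
    by (simp only: integral_mult_right aw_first_moment aw_int_def mult_zero_right diff_zero)
  finally show ?thesis .
qed

end

end

section \<open>Reduction of the four parameters to zero\<close>

lemma cmod_mult_less_one: "cmod a < 1 \<Longrightarrow> cmod b < 1 \<Longrightarrow> cmod (a * b) < 1"
  using mult_strict_mono[of "cmod a" 1 "cmod b" 1] by (simp add: norm_mult)

lemma cis_power2: "cis t ^ 2 = cis (2 * t)"
  by (simp add: power2_eq_square cis_mult flip: mult_2)

text \<open>Adjacent transpositions suffice to bring any parameter into the first place, where the
  recurrence acts.\<close>

lemma aw_weight_swap:
  "aw_weight q a b c d = aw_weight q b a c d"
  "aw_weight q a b c d = aw_weight q a c b d"
  "aw_weight q a b c d = aw_weight q a b d c"
  by (auto simp: aw_weight_def mult_ac)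

lemma aw_int_swap:
  "aw_int q a b c d = aw_int q b a c d"
  "aw_int q a b c d = aw_int q a c b d"
  "aw_int q a b c d = aw_int q a b d c"
  unfolding aw_int_def using aw_weight_swap by metis+

context
  fixes q :: real
  assumes q: "0 < q" "q < 1"
begin

lemma cmod_mult_qpow_less: "cmod c < 1 \<Longrightarrow> cmod (c * of_real q ^ n) < 1"
  using q mult_right_le_one_le[of "cmod c" "q ^ n"] by (simp add: norm_mult norm_power power_le_one)

lemma aw_int_qpow:
  assumes abcd: "cmod a < 1" "cmod b < 1" "cmod c < 1" "cmod d < 1"
  shows "qpoch (a*b*c*d) q n * aw_int q (a * of_real q ^ n) b c d
    = qpoch (a*b) q n * qpoch (a*c) q n * qpoch (a*d) q n * aw_int q a b c d"
proof (induction n)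
  case 0
  then show ?case by simp
next
  case (Suc n)
  let ?Q = "complex_of_real q"
  have "qpoch (a*b*c*d) q (Suc n) * aw_int q (a * ?Q ^ Suc n) b c d
    = qpoch (a*b*c*d) q n * ((1 - (a * ?Q ^ n)*b*c*d) * aw_int q ((a * ?Q ^ n) * ?Q) b c d)"
    unfolding qpoch_Suc by (simp add: mult_ac)
  also have "\<dots> = (qpoch (a*b*c*d) q n * aw_int q (a * ?Q ^ n) b c d) *
     ((1 - (a * ?Q ^ n)*b) * (1 - (a * ?Q ^ n)*c) * (1 - (a * ?Q ^ n)*d))"
    unfolding aw_int_recurrence[OF q cmod_mult_qpow_less[OF abcd(1)] abcd(2-)] by (simp add: mult_ac)
  also have "\<dots> = qpoch (a*b) q (Suc n) * qpoch (a*c) q (Suc n) * qpoch (a*d) q (Suc n) * aw_int q a b c d"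
    unfolding Suc qpoch_Suc by (simp add: mult_ac)
  finally show ?case .
qed

text \<open>The weight is jointly continuous in \<open>a\<close> and \<open>t\<close>, and
  \<open>t\<close> ranges over a compact interval.\<close>

lemma continuous_on_aw_int:
  assumes bcd: "cmod b < 1" "cmod c < 1" "cmod d < 1"
  shows "continuous_on (ball 0 1) (\<lambda>a. aw_int q a b c d)"
proof -
  have "continuous_on (ball 0 1 \<times> cbox 0 pi) (\<lambda>(a, t). aw_weight q a b c d (cis t))"
    unfolding aw_weight_def split_beta
    by (intro continuous_intros continuous_on_aw_den[OF q]) (auto simp: aw_den_nonzero[OF q] bcd)
  then show ?thesis
    unfolding aw_int_def cbox_interval[symmetric] by (rule integral_continuous_on_param)
qed

text \<open>This is the limit of \<open>aw_int_qpow\<close> as \<open>n\<close> grows: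
  \<open>a * q ^ n\<close> tends to 0 and the finite products tend to infinite ones.\<close>

lemma aw_int_eliminate:
  assumes abcd: "cmod a < 1" "cmod b < 1" "cmod c < 1" "cmod d < 1"
  shows "aw_int q a b c d = qpoch_inf (a*b*c*d) q
      / (qpoch_inf (a*b) q * qpoch_inf (a*c) q * qpoch_inf (a*d) q) * aw_int q 0 b c d"
proof -
  have "(\<lambda>n. a * complex_of_real (q ^ n)) \<longlonglongrightarrow> a * of_real 0"
    using q by (intro tendsto_intros LIMSEQ_realpow_zero) auto
  then have "(\<lambda>n. a * of_real q ^ n) \<longlonglongrightarrow> 0" by simp
  then have "(\<lambda>n. aw_int q (a * of_real q ^ n) b c d) \<longlonglongrightarrow> aw_int q 0 b c d"
    using cmod_mult_qpow_less[OF abcd(1)]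
    by (intro continuous_on_tendsto_compose[OF continuous_on_aw_int[OF abcd(2-)]]) auto
  then have "(\<lambda>n. qpoch (a*b*c*d) q n * aw_int q (a * of_real q ^ n) b c d)
     \<longlonglongrightarrow> qpoch_inf (a*b*c*d) q * aw_int q 0 b c d"
    by (intro tendsto_intros qpoch_tendsto_inf[OF q])
  moreover have "(\<lambda>n. qpoch (a*b) q n * qpoch (a*c) q n * qpoch (a*d) q n * aw_int q a b c d)
     \<longlonglongrightarrow> qpoch_inf (a*b) q * qpoch_inf (a*c) q * qpoch_inf (a*d) q * aw_int q a b c d"
    by (intro tendsto_intros qpoch_tendsto_inf[OF q])
  ultimately have "qpoch_inf (a*b*c*d) q * aw_int q 0 b c d
     = qpoch_inf (a*b) q * qpoch_inf (a*c) q * qpoch_inf (a*d) q * aw_int q a b c d"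
    unfolding aw_int_qpow[OF abcd] by (rule LIMSEQ_unique)
  moreover have "qpoch_inf (a*b) q \<noteq> 0" "qpoch_inf (a*c) q \<noteq> 0" "qpoch_inf (a*d) q \<noteq> 0"
    using abcd by (auto intro!: qpoch_inf_nonzero[OF q] cmod_mult_less_one)
  ultimately show ?thesis by (simp add: field_simps)
qed

text \<open>The parameters are eliminated in turn; a product involving a parameter that is already 0
  equals 1.\<close>

lemma aw_int_reduce:
  assumes abcd: "cmod a < 1" "cmod b < 1" "cmod c < 1" "cmod d < 1"
  shows "aw_int q a b c d = qpoch_inf (a*b*c*d) q
      / (qpoch_inf (a*b) q * qpoch_inf (a*c) q * qpoch_inf (a*d) q
         * qpoch_inf (b*c) q * qpoch_inf (b*d) q * qpoch_inf (c*d) q) * aw_int q 0 0 0 0"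
proof -
  have 1: "aw_int q 0 b c d = aw_int q 0 0 c d / (qpoch_inf (b*c) q * qpoch_inf (b*d) q)"
    using aw_int_eliminate[of b 0 c d] abcd aw_int_swap(1)[of q 0 b c d] by simp
  have 2: "aw_int q 0 0 c d = aw_int q 0 0 0 d / qpoch_inf (c*d) q"
    using aw_int_eliminate[of c 0 0 d] abcd aw_int_swap(1)[of q 0 c 0 d] aw_int_swap(2)[of q 0 0 c d]
    by simp
  have 3: "aw_int q 0 0 0 d = aw_int q 0 0 0 0"
    using aw_int_eliminate[of d 0 0 0] abcd aw_int_swap(1)[of q 0 d 0 0] aw_int_swap(2)[of q 0 0 d 0]
       aw_int_swap(3)[of q 0 0 0 d]
    by simp
  show ?thesis unfolding aw_int_eliminate[OF abcd] 1 2 3 by simp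
qed

section \<open>The normalising constant\<close>

lemma qpoch_inf_square: "qpoch_inf c q * qpoch_inf (- c) q = qpoch_inf (c ^ 2) (q ^ 2)"
proof (rule LIMSEQ_unique)
  have "0 < q ^ 2" "q ^ 2 < 1" using q by (auto simp: power_less_one_iff)
  then show "(\<lambda>n. qpoch (c ^ 2) (q ^ 2) n) \<longlonglongrightarrow> qpoch_inf (c ^ 2) (q ^ 2)"
    by (rule qpoch_tendsto_inf)
  have "qpoch (c ^ 2) (q ^ 2) n = qpoch c q n * qpoch (- c) q n" for n
    unfolding qpoch_def prod.distrib[symmetric]
    by (intro prod.cong refl) (simp add: algebra_simps power2_eq_square power_mult_distrib)
  then show "(\<lambda>n. qpoch (c ^ 2) (q ^ 2) n) \<longlonglongrightarrow> qpoch_inf c q * qpoch_inf (- c) q"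
    by (simp only:) (intro tendsto_intros qpoch_tendsto_inf[OF q])
qed

lemma qpoch_inf_even_odd:
  "qpoch_inf c q = qpoch_inf c (q ^ 2) * qpoch_inf (c * of_real q) (q ^ 2)"
proof (rule LIMSEQ_unique)
  have q2: "0 < q ^ 2" "q ^ 2 < 1" using q by (auto simp: power_less_one_iff)
  have "qpoch c q (2 * n) = qpoch c (q ^ 2) n * qpoch (c * of_real q) (q ^ 2) n" for n
    by (induction n) (simp_all add: qpoch_def algebra_simps flip: power_mult)
  moreover have "(\<lambda>n. qpoch c (q ^ 2) n * qpoch (c * of_real q) (q ^ 2) n) \<longlonglongrightarrow>
      qpoch_inf c (q ^ 2) * qpoch_inf (c * of_real q) (q ^ 2)"
    by (intro tendsto_intros qpoch_tendsto_inf[OF q2])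
  ultimately show "(\<lambda>n. qpoch c q (2 * n)) \<longlonglongrightarrow> qpoch_inf c (q ^ 2) * qpoch_inf (c * of_real q) (q ^ 2)"
    by simp
  show "(\<lambda>n. qpoch c q (2 * n)) \<longlonglongrightarrow> qpoch_inf c q"
    using LIMSEQ_subseq_LIMSEQ[OF qpoch_tendsto_inf[OF q], of "\<lambda>n. 2 * n" c] by (simp add: o_def strict_mono_def)
qed

text \<open>Euler's identity: (q;q) splits into (q;q^2) and (q^2;q^2) by parity of the index, the
  latter is (q;q) times (-q;q), and the nonzero (q;q) cancels.\<close>

lemma qpoch_inf_euler: "qpoch_inf (- of_real q) q * qpoch_inf (of_real q) (q ^ 2) = 1"
proof -
  let ?Q = "complex_of_real q"
  have "qpoch_inf ?Q q = qpoch_inf ?Q (q ^ 2) * (qpoch_inf ?Q q * qpoch_inf (- ?Q) q)"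
    unfolding qpoch_inf_square using qpoch_inf_even_odd[of ?Q] by (simp add: power2_eq_square)
  moreover have "qpoch_inf ?Q q \<noteq> 0" using q by (intro qpoch_inf_nonzero[OF q]) auto
  ultimately show ?thesis by (simp add: mult_ac)
qed

text \<open>Splitting (z^2;q) by parity of the index and then by square roots gives the product of
  (z;q), (-z;q), (sz;q), (-sz;q) with s the square root of q. Taking the first factors out of the
  first two leaves exactly the denominator at \<open>z\<close>, so the weight collapses to
  \<open>(1 - z^2) * (1 - 1 / z^2)\<close>.\<close>

lemma integral_aw_special:
  "aw_int q (of_real q) (- of_real q) (of_real (sqrt q)) (- of_real (sqrt q)) = 2 * of_real pi"
proof -
  let ?Q = "complex_of_real q" and ?s = "complex_of_real (sqrt q)"
  have s2: "?s ^ 2 = ?Q" using q by (simp flip: of_real_power)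
  have s: "qpoch_inf (z ^ 2) q = (1 - z^2) * (qpoch_inf (?Q * z) q * qpoch_inf (- ?Q * z) q
      * qpoch_inf (?s * z) q * qpoch_inf (- ?s * z) q)" for z
  proof -
    have "qpoch_inf (z ^ 2) q = (qpoch_inf z q * qpoch_inf (- z) q) * (qpoch_inf (?s * z) q * qpoch_inf (- (?s * z)) q)"
      unfolding qpoch_inf_square using qpoch_inf_even_odd[of "z^2"] by (simp add: power_mult_distrib s2 mult_ac)
    also have "qpoch_inf z q * qpoch_inf (- z) q = (1 - z) * (1 + z) * (qpoch_inf (?Q * z) q * qpoch_inf (- ?Q * z) q)"
      using qpoch_inf_shift[OF q, of z] qpoch_inf_shift[OF q, of "-z"] by (simp add: mult_ac)
    also have "(1 - z) * (1 + z) = 1 - z^2" by (simp add: algebra_simps power2_eq_square)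
    finally show ?thesis by (simp add: mult_ac)
  qed
  have cm: "cmod ?Q < 1" "cmod (- ?Q) < 1" "cmod ?s < 1" "cmod (- ?s) < 1" using q by auto
  have "aw_weight q ?Q (- ?Q) ?s (- ?s) (cis t) = of_real (2 - 2 * cos (2 * t))" for t
  proof -
    define D where "D z = aw_den q ?Q z * aw_den q (- ?Q) z * aw_den q ?s z * aw_den q (- ?s) z" for z
    have "aw_den q 1 (cis t ^ 2) = qpoch_inf (cis t ^ 2) q * qpoch_inf ((1 / cis t) ^ 2) q"
      by (simp add: aw_den_def power_one_over)
    also have "\<dots> = (1 - cis t ^ 2) * (1 - (1 / cis t) ^ 2) * D (cis t)"
      unfolding s D_def aw_den_def by (simp add: mult_ac)
    also have "(1 - cis t ^ 2) * (1 - (1 / cis t) ^ 2) = of_real (2 - 2 * cos (2 * t))"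
    proof -
      have "(1 / cis t) ^ 2 = cis (- (2 * t))" unfolding power_one_over cis_power2 by (simp add: divide_simps flip: cis_inverse)
      then show ?thesis unfolding cis_power2
        by (simp add: algebra_simps cis_mult) (simp add: complex_eq_iff)
    qed
    moreover have "D (cis t) \<noteq> 0" unfolding D_def using cm by (simp add: aw_den_nonzero[OF q])
    ultimately show ?thesis by (simp add: aw_weight_def D_def)
  qed
  then have "aw_int q ?Q (- ?Q) ?s (- ?s) = integral {0..pi} (\<lambda>t. of_real (2 - 2 * cos (2 * t)))"
    by (simp add: aw_int_def)
  also have "\<dots> = of_real (2 * pi)"
  proof (rule integral_unique, rule has_integral_of_real)
    have "((\<lambda>t. 2 - 2 * cos (2 * t)) has_integral (2 * pi - sin (2 * pi) - (2 * 0 - sin (2 * 0)))) {0..pi}"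
      by (intro fundamental_theorem_of_calculus)
        (auto intro!: derivative_eq_intros simp: has_real_derivative_iff_has_vector_derivative[symmetric])
    then show "((\<lambda>t. 2 - 2 * cos (2 * t)) has_integral 2 * pi) {0..pi}" by simp
  qed
  finally show ?thesis by simp
qed

text \<open>The reduction formula is solved for the constant at the parameters of
  \<open>integral_aw_special\<close>; the products other than (q;q) cancel by Euler's identity
  \<open>N * E = 1\<close>.\<close>

lemma aw_int_zero: "aw_int q 0 0 0 0 = 2 * of_real pi / qpoch_inf (of_real q) q"
proof -
  let ?Q = "complex_of_real q" and ?s = "complex_of_real (sqrt q)"
  define N E where "N = qpoch_inf (- ?Q) q" and "E = qpoch_inf ?Q (q ^ 2)"
  have q2: "0 < q ^ 2" "q ^ 2 < 1" using q by (auto simp: power_less_one_iff)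
  have s2: "?s * ?s = ?Q" using q by (simp flip: of_real_mult)
  have cm: "cmod ?Q < 1" "cmod (- ?Q) < 1" "cmod ?s < 1" "cmod (- ?s) < 1" using q by auto
  have "1 - ?Q = of_real (1 - q)" "1 + ?Q = of_real (1 + q)" by simp_all
  then have Q: "1 - ?Q \<noteq> 0" "1 + ?Q \<noteq> 0" "?Q \<noteq> 0"
    using q by (simp_all only: of_real_eq_0_iff)
  have NE: "N * E = 1" unfolding N_def E_def by (rule qpoch_inf_euler)
  have a: "qpoch_inf (?Q * ?s) q * qpoch_inf (- (?Q * ?s)) q = E / (1 - ?Q)"
  proof -
    have "(?Q * ?s) ^ 2 = ?Q * of_real (q ^ 2)" by (simp add: power2_eq_square s2 mult_ac)
    then show ?thesis unfolding qpoch_inf_square 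
      using qpoch_inf_shift[OF q2, of ?Q] Q by (simp add: E_def)
  qed
  have b: "qpoch_inf (- (?Q * ?Q)) q = N / (1 + ?Q)"
    using qpoch_inf_shift[OF q, of "- ?Q"] Q by (simp add: N_def)
  have c: "qpoch_inf (?Q * ?Q * ?Q) q = qpoch_inf ?Q q / ((1 - ?Q) * (1 - ?Q * ?Q))"
  proof -
    have "1 - ?Q * ?Q = (1 - ?Q) * (1 + ?Q)" by (simp add: algebra_simps)
    then have "1 - ?Q * ?Q \<noteq> 0" using Q by simp
    then show ?thesis
      using qpoch_inf_shift[OF q, of "?Q"] qpoch_inf_shift[OF q, of "?Q * ?Q"] Q by simp
  qed
  have nz: "qpoch_inf ?Q q \<noteq> 0" using cm by (intro qpoch_inf_nonzero[OF q])
  \<comment> \<open>The product of all four parameters is \<open>?Q ^ 3\<close>. Their pairwise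
    products are \<open>- ?Q ^ 2\<close>, \<open>- ?Q\<close>, and \<open>?Q * ?s\<close> and its
    negative twice each, whence the square.\<close>
  have "2 * of_real pi = qpoch_inf (?Q * ?Q * ?Q) q / 
      (qpoch_inf (- (?Q * ?Q)) q * (qpoch_inf (?Q * ?s) q * qpoch_inf (- (?Q * ?s)) q) ^ 2 * N) * aw_int q 0 0 0 0"
    using aw_int_reduce[OF cm] unfolding integral_aw_special
    by (simp add: N_def s2 power2_eq_square mult_ac)
  also have "\<dots> = qpoch_inf ?Q q / ((1 - ?Q) * (1 - ?Q * ?Q)) / (N / (1 + ?Q) * (E / (1 - ?Q)) ^ 2 * N) * aw_int q 0 0 0 0"
    unfolding a b c ..
  also have "N / (1 + ?Q) * (E / (1 - ?Q)) ^ 2 * N = (N * E) ^ 2 / ((1 - ?Q) * ((1 - ?Q) * (1 + ?Q)))"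
    by (simp add: power2_eq_square mult_ac)
  also have "\<dots> = 1 / ((1 - ?Q) * (1 - ?Q * ?Q))"
    unfolding NE by (simp add: algebra_simps)
  finally have "2 * of_real pi = qpoch_inf ?Q q * aw_int q 0 0 0 0"
    using Q by (simp add: b) (auto simp: algebra_simps)
  then show ?thesis using nz by simp
qed

theorem askey_wilson_integral:
  assumes abcd: "cmod a < 1" "cmod b < 1" "cmod c < 1" "cmod d < 1"
  shows "aw_int q a b c d = 2 * of_real pi * qpoch_inf (a*b*c*d) q
      / (qpoch_inf (of_real q) q * qpoch_inf (a*b) q * qpoch_inf (a*c) q * qpoch_inf (a*d) q
         * qpoch_inf (b*c) q * qpoch_inf (b*d) q * qpoch_inf (c*d) q)"
  unfolding aw_int_reduce[OF abcd] aw_int_zero by (simp add: mult_ac)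

end

section \<open>The terminating series under the Askey--Wilson weight\<close>

lemma exp_i_cis: "exp (\<i> * of_real t) = cis t" "exp (- \<i> * of_real t) = 1 / cis t"
  by (simp_all add: cis_conv_exp exp_minus field_simps)

lemma askey_h_ratio:
  "askey_h q (2 * t) [1] / askey_h q t [a, b, c, d] = aw_weight q a b c d (cis t)"
proof -
  have "askey_h q (2 * t) [1] = aw_den q 1 (cis t ^ 2)"
    unfolding askey_h_def qpochs_inf_def exp_i_cis by (simp add: aw_den_def cis_power2)
  moreover have "askey_h q t [a, b, c, d] = aw_den q a (cis t) * aw_den q b (cis t) * aw_den q c (cis t) * aw_den q d (cis t)"
    unfolding askey_h_def qpochs_inf_def exp_i_cis by (simp add: aw_den_def mult_ac)
  ultimately show ?thesis by (simp add: aw_weight_def)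
qed

section \<open>The 4-phi-3 as a q-binomial transform\<close>

text \<open>The q-binomial coefficient and the power of \<open>q\<close> are left out, so that
  \<open>aw_phi\<close> has the shape treated in \<open>qbinomial_transform_bound\<close>.\<close>

definition aw_phi_term :: "real \<Rightarrow> complex \<Rightarrow> complex \<Rightarrow> complex \<Rightarrow> complex \<Rightarrow> complex \<Rightarrow> nat \<Rightarrow> complex" where
  "aw_phi_term q a b c d z n = qpoch (a*b*c*d) q n * qpoch (a * z) q n * qpoch (a / z) q n
     / (qpoch (a*b) q n * qpoch (a*c) q n * qpoch (a*d) q n)"

definition aw_phi :: "real \<Rightarrow> complex \<Rightarrow> complex \<Rightarrow> complex \<Rightarrow> complex \<Rightarrow> nat \<Rightarrow> complex \<Rightarrow> complex" where
  "aw_phi q a b c d k z = (\<Sum>n\<le>k. qpoch (1 / of_real q ^ k) q n / qpoch (of_real q) q n * of_real q ^ n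
      * aw_phi_term q a b c d z n)"

context
  fixes q :: real
  assumes q: "0 < q" "q < 1"
begin

lemma qpoch_inf_mult_qpow:
  assumes "cmod c < 1"
  shows "qpoch_inf (c * of_real q ^ n) q = qpoch_inf c q / qpoch c q n"
  using qpoch_inf_split[OF q, of c n] qpoch_nonzero[OF q assms, of n] by simp

lemma qpoch_terminates:
  assumes "k < n"
  shows "qpoch (1 / of_real q ^ k) q n = 0"
  unfolding qpoch_def using assms q by (auto intro!: bexI[of _ k])

text \<open>With four upper and three lower parameters the exponent 1 + s - r is 0, so the sign and
  power factor is 1. The terms beyond \<open>k\<close> vanish by
  \<open>qpoch_terminates\<close>.\<close>

lemma basic_hyp_aw_phi:
  "basic_hyp [1 / of_real q ^ k, a * b * c * d, a * exp (\<i> * of_real t), a * exp (- \<i> * of_real t)]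
      [a * b, a * c, a * d] q (of_real q) = aw_phi q a b c d k (cis t)"
  unfolding basic_hyp_def aw_phi_def exp_i_cis
  by (subst suminf_finite[where N = "{..k}"])
    (auto simp: qpochs_def aw_phi_term_def qpoch_terminates mult_ac intro!: sum.cong)

lemma cmod_qpow_real: "cmod (of_real (q powr s)) \<le> 1" if "0 \<le> s"
  using powr_le1[of s q] that q by simp

text \<open>The ratio consists of four infinite products. As \<open>q powr s\<close> is at most 1,
  the arguments stay in fixed discs, and the one in the denominator that depends on \<open>s\<close>
  stays within radius \<open>cmod c < 1\<close>.\<close>

lemma qpoch_real_ratio_bounded:
  fixes c :: complex
  assumes "cmod c < 1"
  obtains B where "B > 0" "\<And>s. 0 \<le> s \<Longrightarrow> cmod (qpoch_real c q s / qpoch_real (of_real q) q s) \<le> B"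
proof -
  obtain M where M: "M > 0" "\<And>w. cmod w \<le> 1 \<Longrightarrow> cmod (qpoch_inf w q) \<le> M"
    using qpoch_inf_bounded[OF q, of 1] by blast
  obtain L where L: "L > 0" "\<And>w. cmod w \<le> cmod c \<Longrightarrow> cmod (inverse (qpoch_inf w q)) \<le> L"
    using inverse_qpoch_inf_bounded[OF q assms] by blast
  define K where "K = cmod (inverse (qpoch_inf (of_real q) q))"
  have "qpoch_inf (of_real q) q \<noteq> 0" using q by (intro qpoch_inf_nonzero[OF q]) auto
  then have K: "K > 0" by (simp add: K_def)
  show ?thesis
  proof
    show "M * L * (M * K) > 0" using M L K by simp
    fix s :: real assume s: "0 \<le> s"
    let ?p = "complex_of_real (q powr s)"
    have le: "cmod (c * ?p) \<le> cmod c" "cmod (of_real q * ?p) \<le> 1"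
      using cmod_qpow_real[OF s] q mult_le_one[of q "cmod ?p"]
      by (auto simp del: norm_of_real simp: norm_mult norm_of_real[of q] intro!: mult_right_le_one_le)
    have "qpoch_real c q s / qpoch_real (of_real q) q s
      = qpoch_inf c q * inverse (qpoch_inf (c * ?p) q) *
         (qpoch_inf (of_real q * ?p) q * inverse (qpoch_inf (of_real q) q))"
      by (simp add: qpoch_real_def divide_inverse)
    also have "cmod \<dots> \<le> M * L * (M * K)"
      unfolding norm_mult K_def using M L le assms
      by (intro mult_mono mult_nonneg_nonneg) auto
    finally show "cmod (qpoch_real c q s / qpoch_real (of_real q) q s) \<le> M * L * (M * K)" .
  qed
qed

context
  fixes a b c d :: complex
  assumes abcd: "cmod a < 1" "cmod b < 1" "cmod c < 1" "cmod d < 1"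
begin

lemma aw_products_less: "cmod (a * b) < 1" "cmod (a * c) < 1" "cmod (a * d) < 1" "cmod (a * b * c * d) < 1"
  using abcd by (auto intro!: cmod_mult_less_one)

lemma continuous_on_aw_phi_term: "continuous_on A (\<lambda>t. aw_phi_term q a b c d (cis t) n)"
  unfolding aw_phi_term_def
  by (intro continuous_intros) (auto simp: qpoch_def[of "a * cis _"] qpoch_def[of "a / cis _"]
     qpoch_nonzero[OF q] aw_products_less intro!: continuous_intros)

lemma continuous_on_aw_phi: "continuous_on A (\<lambda>t. aw_phi q a b c d k (cis t))"
  unfolding aw_phi_def
  by (intro continuous_intros continuous_on_aw_phi_term) (use q in \<open>auto intro!: qpoch_nonzero[OF q]\<close>)

text \<open>The finite products at \<open>a * z\<close> and \<open>a / z\<close> cancel the first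
  \<open>n\<close> factors of the two infinite products in \<open>aw_den q a z\<close>.\<close>

lemma aw_weight_phi_term:
  assumes "cmod z = 1"
  shows "aw_weight q a b c d z * aw_phi_term q a b c d z n = 
     qpoch (a*b*c*d) q n / (qpoch (a*b) q n * qpoch (a*c) q n * qpoch (a*d) q n)
      * aw_weight q (a * of_real q ^ n) b c d z"
proof -
  have l: "cmod (a * z) < 1" "cmod (a / z) < 1" using abcd assms by (auto simp: norm_mult norm_divide)
  have "aw_den q (a * of_real q ^ n) z = aw_den q a z / (qpoch (a * z) q n * qpoch (a / z) q n)"
    using qpoch_inf_mult_qpow[OF l(1), of n] qpoch_inf_mult_qpow[OF l(2), of n]
    by (simp add: aw_den_def mult_ac)
  then show ?thesis by (simp add: aw_weight_def aw_phi_term_def mult_ac)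
qed

text \<open>By \<open>aw_int_qpow\<close> the quotient of finite products exactly offsets the change
  from \<open>a\<close> to \<open>a * q ^ n\<close>, so the value does not depend on
  \<open>n\<close>.\<close>

lemma integral_aw_weight_phi_term:
  "((\<lambda>t. aw_weight q a b c d (cis t) * aw_phi_term q a b c d (cis t) n) has_integral aw_int q a b c d) {0..pi}"
proof -
  let ?K = "qpoch (a*b*c*d) q n / (qpoch (a*b) q n * qpoch (a*c) q n * qpoch (a*d) q n)"
  have "((\<lambda>t. aw_weight q (a * of_real q ^ n) b c d (cis t)) has_integral aw_int q (a * of_real q ^ n) b c d) {0..pi}"
    unfolding aw_int_def using abcd
    by (intro integrable_integral integrable_continuous_real continuous_on_aw_weight[OF q] cmod_mult_qpow_less[OF q])
  then have "((\<lambda>t. ?K * aw_weight q (a * of_real q ^ n) b c d (cis t)) has_integral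
      ?K * aw_int q (a * of_real q ^ n) b c d) {0..pi}"
    by (rule has_integral_mult_right)
  moreover have "?K * aw_int q (a * of_real q ^ n) b c d = aw_int q a b c d"
    using aw_int_qpow[OF q abcd, of n] qpoch_nonzero[OF q] aw_products_less by (simp add: field_simps)
  ultimately show ?thesis by (simp add: aw_weight_phi_term)
qed

text \<open>All terms have the same integral, which is thus multiplied by the q-binomial polynomial
  at \<open>z = q\<close>; its factor with \<open>j = 0\<close> vanishes unless
  \<open>k = 0\<close>.\<close>

lemma integral_aw_weight_phi:
  "((\<lambda>t. aw_weight q a b c d (cis t) * aw_phi q a b c d k (cis t)) has_integral
      (if k = 0 then aw_int q a b c d else 0)) {0..pi}"
proof -
  let ?Q = "complex_of_real q"
  define g where "g n = qpoch (1 / ?Q ^ k) q n / qpoch ?Q q n * ?Q ^ n" for n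
  have "((\<lambda>t. \<Sum>n\<le>k. g n * (aw_weight q a b c d (cis t) * aw_phi_term q a b c d (cis t) n)) has_integral
     (\<Sum>n\<le>k. g n * aw_int q a b c d)) {0..pi}"
    by (intro has_integral_sum has_integral_mult_right integral_aw_weight_phi_term) auto
  moreover have "(\<Sum>n\<le>k. g n) = (if k = 0 then 1 else 0)"
    unfolding g_def qbinomial_sum[OF q] using q by (auto intro!: bexI[of _ 0])
  then have "(\<Sum>n\<le>k. g n * aw_int q a b c d) = (if k = 0 then aw_int q a b c d else 0)"
    by (simp flip: sum_distrib_right)
  ultimately show ?thesis
    by (simp add: aw_phi_def g_def sum_distrib_left mult_ac)
qed

text \<open>Writing finite products as quotients of infinite ones turns the n-th term into
  \<open>f (?Q ^ n)\<close> with \<open>f\<close> holomorphic on the disc of radius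
  \<open>1 / cmod a\<close>, which contains the circle of radius \<open>1 / r\<close>. The bound on
  \<open>f\<close> there is uniform in \<open>t\<close>, as it uses only that \<open>cis t\<close>
  has modulus 1.\<close>

lemma aw_phi_bound:
  assumes a0: "a \<noteq> 0" and r: "cmod a < r" "r < 1"
  obtains C where "C > 0" "\<And>k t. cmod (aw_phi q a b c d k (cis t)) \<le> C * r ^ k"
proof -
  let ?Q = "complex_of_real q"
  have r0: "0 < r" using r norm_ge_zero[of a] by linarith
  \<comment> \<open>For \<open>cmod w = 1 / r\<close> and \<open>cmod v \<le> 1\<close> the argument
    \<open>a * v * w\<close> has modulus at most \<open>\<rho>\<close>; since
    \<open>cmod a \<le> \<rho>\<close>, the same \<open>L\<close> also serves the factors without
    \<open>w\<close>.\<close>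
  define \<rho> where "\<rho> = cmod a / r"
  have \<rho>: "\<rho> < 1" "cmod a \<le> \<rho>" using r r0 mult_left_le[of r "cmod a"] by (auto simp: \<rho>_def field_simps)
  obtain M where M: "M > 0" "\<And>w. cmod w \<le> 1 \<Longrightarrow> cmod (qpoch_inf w q) \<le> M"
    using qpoch_inf_bounded[OF q, of 1] by blast
  obtain L where L: "L > 0" "\<And>w. cmod w \<le> \<rho> \<Longrightarrow> cmod (inverse (qpoch_inf w q)) \<le> L"
    using inverse_qpoch_inf_bounded[OF q \<rho>(1)] by blast
  define C where "C = (M * M * M * (L * L * L)) * (M * M * M * (L * L * L))"
  have "C > 0" using M L by (simp add: C_def)
  have le: "cmod (a * w) \<le> cmod a" if "cmod w \<le> 1" for w
    using that by (simp add: norm_mult mult_left_le)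
  have M0: "0 \<le> M" and L0: "0 \<le> L" using M L by simp_all
  have bcd1: "cmod b \<le> 1" "cmod c \<le> 1" "cmod d \<le> 1" using abcd by simp_all
  have bcd: "cmod (b * c * d) \<le> 1"
    using abcd by (intro less_imp_le cmod_mult_less_one) 
  have "cmod (aw_phi q a b c d k (cis t)) \<le> C / (1 - r) * r ^ k" for k t
  proof -
    define z where "z = cis t"
    have z: "cmod z \<le> 1" "cmod (1 / z) \<le> 1" by (auto simp: z_def norm_divide)
    \<comment> \<open>\<open>K\<close> collects the infinite products free of \<open>n\<close>.
      Every argument is written as \<open>a * v\<close> with \<open>cmod v \<le> 1\<close>, so that
      one estimate covers all six.\<close>
    define K where "K = qpoch_inf (a * (b * c * d)) q * qpoch_inf (a * z) q * qpoch_inf (a * (1 / z)) q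
      * (inverse (qpoch_inf (a * b) q) * inverse (qpoch_inf (a * c) q) * inverse (qpoch_inf (a * d) q))"
    define f where "f w = K * (qpoch_inf (a * b * w) q * qpoch_inf (a * c * w) q * qpoch_inf (a * d * w) q
      * (inverse (qpoch_inf (a * (b * c * d) * w) q) * inverse (qpoch_inf (a * z * w) q) * inverse (qpoch_inf (a * (1 / z) * w) q)))" for w
    have K: "cmod K \<le> M * M * M * (L * L * L)"
    proof -
      have m: "cmod (qpoch_inf (a * v) q) \<le> M" "cmod (inverse (qpoch_inf (a * v) q)) \<le> L" if "cmod v \<le> 1" for v
        using M(2)[of "a * v"] L(2)[of "a * v"] le[OF that] \<rho> by auto
      show ?thesis
        unfolding K_def norm_mult
        by (intro mult_mono m mult_nonneg_nonneg norm_ge_zero M0 L0 z bcd bcd1)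
    qed
    have nz: "qpoch_inf (a * v * w) q \<noteq> 0" if "cmod v \<le> 1" "w \<in> ball 0 (1 / cmod a)" for v w
    proof (rule qpoch_inf_nonzero[OF q])
      have "cmod (a * v * w) = cmod (a * v) * cmod w" by (simp add: norm_mult)
      also have "\<dots> \<le> cmod a * cmod w" using le[OF that(1)] by (rule mult_right_mono) simp
      also have "\<dots> < 1" using that(2) a0 by (simp add: field_simps)
      finally show "cmod (a * v * w) < 1" .
    qed
    have hol: "f holomorphic_on ball 0 (1 / cmod a)"
    proof -
      have h: "(\<lambda>w. qpoch_inf (a * v * w) q) holomorphic_on A" for v A
        by (intro holomorphic_intros holomorphic_qpoch_inf[OF q])
      have hi: "(\<lambda>w. inverse (qpoch_inf (a * v * w) q)) holomorphic_on ball 0 (1 / cmod a)" if "cmod v \<le> 1" for v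
        by (rule holomorphic_on_inverse[OF h nz[OF that]])
      show ?thesis
        unfolding f_def by (intro holomorphic_on_mult holomorphic_on_const h hi z bcd)
    qed
    have bound: "cmod (f w) \<le> C" if "cmod w = 1 / r" for w
    proof -
      have m: "cmod (qpoch_inf (a * v * w) q) \<le> M" "cmod (inverse (qpoch_inf (a * v * w) q)) \<le> L"
        if "cmod v \<le> 1" for v
      proof -
        have "cmod (a * v * w) = cmod (a * v) / r" using \<open>cmod w = 1 / r\<close> by (simp add: norm_mult)
        also have "\<dots> \<le> \<rho>" unfolding \<rho>_def using le[OF that] r0 by (simp add: divide_right_mono)
        finally show "cmod (qpoch_inf (a * v * w) q) \<le> M" "cmod (inverse (qpoch_inf (a * v * w) q)) \<le> L"
          using M(2)[of "a * v * w"] L(2)[of "a * v * w"] \<rho> by auto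
      qed
      show ?thesis
        unfolding f_def C_def norm_mult
        by (intro mult_mono m mult_nonneg_nonneg norm_ge_zero M0 L0 z bcd bcd1 K)
    qed
    have "f (?Q ^ n) = aw_phi_term q a b c d z n" for n
    proof -
      have s: "qpoch_inf (a * v * ?Q ^ n) q = qpoch_inf (a * v) q / qpoch (a * v) q n"
        "qpoch_inf (a * v) q \<noteq> 0" "qpoch (a * v) q n \<noteq> 0" if "cmod v \<le> 1" for v
      proof -
        have "cmod (a * v) < 1" using le[OF that] abcd by simp
        then show "qpoch_inf (a * v * ?Q ^ n) q = qpoch_inf (a * v) q / qpoch (a * v) q n"
          "qpoch_inf (a * v) q \<noteq> 0" "qpoch (a * v) q n \<noteq> 0"
          by (rule qpoch_inf_mult_qpow qpoch_inf_nonzero[OF q] qpoch_nonzero[OF q])+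
      qed
      note ss = s[OF bcd] s[OF bcd1(1)] s[OF bcd1(2)] s[OF bcd1(3)] s[OF z(1)] s[OF z(2)]
      have cancel: "K1 * K2 * K3 * (inverse K4 * inverse K5 * inverse K6) *
         (K4 / x4 * (K5 / x5) * (K6 / x6) * (inverse (K1 / x1) * inverse (K2 / x2) * inverse (K3 / x3)))
        = x1 * x2 * x3 / (x4 * x5 * x6)"
        if "K1 \<noteq> 0" "K2 \<noteq> 0" "K3 \<noteq> 0" "K4 \<noteq> 0" "K5 \<noteq> 0" "K6 \<noteq> 0" 
        for K1 K2 K3 K4 K5 K6 x1 x2 x3 x4 x5 x6 :: complex
        using that by (simp add: field_simps)
      have "f (?Q ^ n) = qpoch (a * (b * c * d)) q n * qpoch (a * z) q n * qpoch (a * (1 / z)) q n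
         / (qpoch (a * b) q n * qpoch (a * c) q n * qpoch (a * d) q n)"
        unfolding f_def K_def ss(1,4,7,10,13,16) by (rule cancel) (rule ss)+
      then show ?thesis by (simp add: aw_phi_term_def mult_ac)
    qed
    then show ?thesis
      using qbinomial_transform_bound[OF q hol r0 r(2) _ bound, of k] r r0 a0
      by (simp add: aw_phi_def z_def frac_less2)
  qed
  moreover have "C / (1 - r) > 0" using \<open>C > 0\<close> r by simp
  ultimately show ?thesis using that by blast
qed

end

end

section \<open>Interchange of the outer sum with the integral\<close>

theorem theorem8:
  fixes q \<alpha> a x :: real and b c d :: complex
  assumes "0 < q" and "q < 1"
    and "0 < \<alpha>"
    and "0 < a" and "a < x" and "x < 1"
    and "Max {\<bar>a\<bar>, cmod b, cmod c, cmod d} < 1"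
  shows "(\<forall>\<theta>\<in>{0..pi}. summable (\<lambda>k.
            of_real (x powr (\<alpha> + real k)) * qpoch_real (of_real (a / x)) q (\<alpha> + real k)
              / (of_real a ^ k * qpoch_real (of_real q) q (\<alpha> + real k))
            * basic_hyp [1 / of_real q ^ k, of_real a * b * c * d,
                         of_real a * exp (\<i> * of_real \<theta>), of_real a * exp (- \<i> * of_real \<theta>)]
                        [of_real a * b, of_real a * c, of_real a * d] q (of_real q)))
       \<and> ((\<lambda>\<theta>. askey_h q (2 * \<theta>) [1] / askey_h q \<theta> [of_real a, b, c, d]
            * (\<Sum>k. of_real (x powr (\<alpha> + real k)) * qpoch_real (of_real (a / x)) q (\<alpha> + real k)
              / (of_real a ^ k * qpoch_real (of_real q) q (\<alpha> + real k))
            * basic_hyp [1 / of_real q ^ k, of_real a * b * c * d,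
                         of_real a * exp (\<i> * of_real \<theta>), of_real a * exp (- \<i> * of_real \<theta>)]
                        [of_real a * b, of_real a * c, of_real a * d] q (of_real q)))
          has_integral
            (2 * of_real pi * qpoch_inf (of_real a * b * c * d) q
              / qpochs_inf [of_real q, of_real a * b, of_real a * c, of_real a * d, b * c, b * d, c * d] q
            * (of_real (x powr \<alpha>) * qpoch_real (of_real (a / x)) q \<alpha> / qpoch_real (of_real q) q \<alpha>)))
          {0..pi}"
proof -
  note q = assms(1,2)
  let ?A = "complex_of_real a"
  have abcd: "cmod ?A < 1" "cmod b < 1" "cmod c < 1" "cmod d < 1" and A0: "?A \<noteq> 0"
    using assms by auto
  define g where "g k = of_real (x powr (\<alpha> + real k)) * qpoch_real (of_real (a / x)) q (\<alpha> + real k)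
              / (?A ^ k * qpoch_real (of_real q) q (\<alpha> + real k))" for k
  define W where "W t = aw_weight q ?A b c d (cis t)" for t
  define \<phi> where "\<phi> k t = aw_phi q ?A b c d k (cis t)" for k t
  \<comment> \<open>The rate \<open>r\<close> must exceed \<open>a\<close> for
    \<open>aw_phi_bound\<close> and lie below \<open>a / x\<close> so that it beats the growth
    \<open>(x / a) ^ k\<close> of the coefficients.\<close>
  have "a < a / x" using assms by (simp add: field_simps)
  then obtain r where r: "a < r" "r < a / x" using dense by blast
  have "a / x < 1" using assms by simp
  then have "r < 1" using r by simp
  have ax: "cmod (of_real (a / x)) < 1"
    using \<open>a / x < 1\<close> assms by (simp only: norm_of_real) simp
  obtain C where C: "C > 0" "\<And>k t. cmod (\<phi> k t) \<le> C * r ^ k"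
    using aw_phi_bound[OF q abcd A0, of r] r \<open>r < 1\<close> assms(4) unfolding \<phi>_def by auto
  obtain B where B: "B > 0" "\<And>s. 0 \<le> s \<Longrightarrow> cmod (qpoch_real (of_real (a / x)) q s / qpoch_real (of_real q) q s) \<le> B"
    using qpoch_real_ratio_bounded[OF q ax] by blast
  have "compact (W ` {0..pi})"
    unfolding W_def by (intro compact_continuous_image continuous_on_aw_weight[OF q abcd]) auto
  then obtain D where D: "D > 0" "\<And>t. t \<in> {0..pi} \<Longrightarrow> cmod (W t) \<le> D"
    using compact_imp_bounded bounded_pos by (metis imageI)
  have g: "cmod (g k) \<le> B * (x / a) ^ k" for k
  proof -
    have "g k = of_real (x powr \<alpha>) * (of_real (x / a)) ^ k * 
       (qpoch_real (of_real (a / x)) q (\<alpha> + real k) / qpoch_real (of_real q) q (\<alpha> + real k))"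
      using assms by (simp add: g_def powr_add powr_realpow power_divide)
    also have "cmod \<dots> \<le> 1 * (x / a) ^ k * B"
      unfolding norm_mult using assms B powr_le1[of \<alpha> x]
      by (intro mult_mono) (auto simp: norm_power norm_divide)
    finally show ?thesis by (simp add: mult_ac)
  qed
  have g\<phi>: "cmod (g k * \<phi> k t) \<le> B * C * (x / a * r) ^ k" for k t
  proof -
    have "cmod (g k * \<phi> k t) \<le> (B * (x / a) ^ k) * (C * r ^ k)"
      unfolding norm_mult using g C(2) B assms by (intro mult_mono) auto
    then show ?thesis by (simp only: power_mult_distrib mult_ac)
  qed
  have "\<bar>x / a * r\<bar> < 1" using r assms by (auto simp: abs_mult field_simps)
  then have geo: "summable (\<lambda>k. K * (x / a * r) ^ k)" for K
    by (intro summable_mult summable_geometric) simp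
  have sm: "summable (\<lambda>k. g k * \<phi> k t)" for t
    by (rule summable_comparison_test'[OF geo g\<phi>])
  \<comment> \<open>The weight is bounded by \<open>D\<close>, so the geometric majorant of the
    series survives multiplication by it and the M-test applies.\<close>
  have "uniform_limit {0..pi} (\<lambda>n t. \<Sum>k<n. W t * (g k * \<phi> k t)) (\<lambda>t. \<Sum>k. W t * (g k * \<phi> k t)) sequentially"
  proof (rule Weierstrass_m_test)
    show "cmod (W t * (g k * \<phi> k t)) \<le> D * (B * C) * (x / a * r) ^ k" if "t \<in> {0..pi}" for k t
      using mult_mono[OF D(2)[OF that] g\<phi>[of k t]] D(1) by (simp add: norm_mult mult.assoc)
  qed (rule geo)
  then have ul: "uniform_limit {0..pi} (\<lambda>n t. \<Sum>k<n. W t * (g k * \<phi> k t)) (\<lambda>t. W t * (\<Sum>k. g k * \<phi> k t)) sequentially"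
    by (simp add: suminf_mult[OF sm])
  have cont: "continuous_on {0..pi} (\<lambda>t. \<Sum>k<n. W t * (g k * \<phi> k t))" for n
    unfolding W_def \<phi>_def
    by (intro continuous_intros continuous_on_aw_weight[OF q abcd] continuous_on_aw_phi[OF q abcd])
  obtain I J where IJ: "\<And>n. ((\<lambda>t. \<Sum>k<n. W t * (g k * \<phi> k t)) has_integral I n) {0..pi}"
      "((\<lambda>t. W t * (\<Sum>k. g k * \<phi> k t)) has_integral J) {0..pi}" "I \<longlonglongrightarrow> J"
    using uniform_limit_integral[OF ul cont] by auto
  \<comment> \<open>Every partial sum that includes the term \<open>k = 0\<close> has the same
    integral, so the sequence \<open>I\<close> is constant from 1 on.\<close>
  have "I n = g 0 * aw_int q ?A b c d" if "n > 0" for n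
  proof -
    have "((\<lambda>t. \<Sum>k<n. g k * (W t * \<phi> k t)) has_integral (\<Sum>k<n. g k * (if k = 0 then aw_int q ?A b c d else 0))) {0..pi}"
      unfolding W_def \<phi>_def
      by (intro has_integral_sum has_integral_mult_right integral_aw_weight_phi[OF q abcd]) auto
    then have "I n = (\<Sum>k<n. g k * (if k = 0 then aw_int q ?A b c d else 0))"
      using IJ(1)[of n] by (intro has_integral_unique) (simp_all add: mult_ac)
    also have "\<dots> = g 0 * aw_int q ?A b c d"
      using that by (simp add: if_distrib cong: if_cong)
    finally show ?thesis .
  qed
  then have "I \<longlonglongrightarrow> g 0 * aw_int q ?A b c d"
    by (intro tendsto_eventually eventually_sequentiallyI[of 1]) auto
  then have J: "J = aw_int q ?A b c d * g 0" using LIMSEQ_unique[OF IJ(3)] by (simp add: mult.commute)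
  show ?thesis
    unfolding basic_hyp_aw_phi[OF q] askey_h_ratio
    using sm IJ(2) unfolding J askey_wilson_integral[OF q abcd]
    by (simp add: g_def W_def \<phi>_def qpochs_inf_def mult_ac)
qed

end
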